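(* There exist an absolute constant $C>0$ and, for each integer $d\ge 2$, constants $\varepsilon_d>0$ and $c_d>0$ with $\varepsilon_d\le C(\log d)^{-1}$, such that for every integer $d\ge 2$ and every prime $q$, $$\mathrm{IM}(d,q)\ \ge\ c_d\, q^{d-\varepsilon_d}.$$
   Context: For an integer $d\ge 1$ and a prime power $q$, $\mathrm{IM}(d,q)$ denotes the maximum size of an induced matching in the bipartite point-line incidence graph of $\mathbb{F}_q^d$; equivalently, the largest $m$ for which there exist pairs $(p_1,\ell_1),\dots,(p_m,\ell_m)$ with $p_i\in\mathbb{F}_q^d$ points and $\ell_j\subset\mathbb{F}_q^d$ affine lines such that $p_i\in\ell_j$ if and only if $i=j$. *)

theory Defs
  imports Complex_Main "HOL-Number_Theory.Residues"
begin

text \<open>A simple graph is given by its edge set, a set of two-element vertex sets.  An induced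
  matching is a set of pairwise disjoint edges such that no edge of the graph joins two of them.\<close>

definition induced_matching :: "'v set set \<Rightarrow> 'v set set \<Rightarrow> bool" where
  "induced_matching E M \<longleftrightarrow> M \<subseteq> E \<and>
     (\<forall>e\<in>M. \<forall>f\<in>M. e \<noteq> f \<longrightarrow> e \<inter> f = {} \<and> (\<forall>x\<in>e. \<forall>y\<in>f. {x, y} \<notin> E))"

text \<open>The dimension varies inside the final statement, so the vectors of \<open>F\<^sup>d\<close> are functions with
  values in \<open>carrier F\<close> on the indices below \<open>d\<close> and \<open>undefined\<close> at all other indices (the
  extensional function space), which makes equality of vectors plain equality.\<close>

definition points :: "('a, 'b) ring_scheme \<Rightarrow> nat \<Rightarrow> (nat \<Rightarrow> 'a) set" where
  "points F d = {..<d} \<rightarrow>\<^sub>E carrier F"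

definition line_through ::
    "('a, 'b) ring_scheme \<Rightarrow> nat \<Rightarrow> (nat \<Rightarrow> 'a) \<Rightarrow> (nat \<Rightarrow> 'a) \<Rightarrow> (nat \<Rightarrow> 'a) set" where
  "line_through F d a v = (\<lambda>t. \<lambda>i\<in>{..<d}. a i \<oplus>\<^bsub>F\<^esub> t \<otimes>\<^bsub>F\<^esub> v i) ` carrier F"

definition affine_lines :: "('a, 'b) ring_scheme \<Rightarrow> nat \<Rightarrow> (nat \<Rightarrow> 'a) set set" where
  "affine_lines F d = {line_through F d a v | a v.
     a \<in> points F d \<and> v \<in> points F d \<and> (\<exists>i<d. v i \<noteq> \<zero>\<^bsub>F\<^esub>)}"

definition incidence_edges ::
    "('a, 'b) ring_scheme \<Rightarrow> nat \<Rightarrow> ((nat \<Rightarrow> 'a) + (nat \<Rightarrow> 'a) set) set set" where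
  "incidence_edges F d = {{Inl p, Inr l} | p l. p \<in> points F d \<and> l \<in> affine_lines F d \<and> p \<in> l}"

text \<open>\<open>IM F d\<close> is \<open>IM(d, q)\<close> for a finite field \<open>F\<close> with \<open>q\<close> elements.  The maximum is over a finite
  nonempty set when \<open>carrier F\<close> is finite.\<close>

definition IM :: "('a, 'b) ring_scheme \<Rightarrow> nat \<Rightarrow> nat" where
  "IM F d = Max {card M | M. induced_matching (incidence_edges F d) M}"

lemma finite_incidence_edges:
  assumes "finite (carrier F)"
  shows "finite (incidence_edges F d)"
proof -
  have fp: "finite (points F d)"
    unfolding points_def using assms by (intro finite_PiE) auto
  have "affine_lines F d \<subseteq> (\<lambda>(a, v). line_through F d a v) ` (points F d \<times> points F d)"
    unfolding affine_lines_def by auto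
  hence fl: "finite (affine_lines F d)"
    using fp by (meson finite_SigmaI finite_imageI finite_subset)
  have "incidence_edges F d \<subseteq> (\<lambda>(p, l). {Inl p, Inr l}) ` (points F d \<times> affine_lines F d)"
    unfolding incidence_edges_def by auto
  thus ?thesis
    using fp fl by (meson finite_SigmaI finite_imageI finite_subset)
qed

lemma le_IM_iff:
  assumes "finite (carrier F)"
  shows "m \<le> IM F d \<longleftrightarrow> (\<exists>M. induced_matching (incidence_edges F d) M \<and> card M = m)"
proof -
  let ?E = "incidence_edges F d"
  let ?S = "{card M | M. induced_matching ?E M}"
  have sub: "M \<subseteq> ?E" if "induced_matching ?E M" for M
    using that unfolding induced_matching_def by blast
  have "?S \<subseteq> card ` Pow ?E"
    using sub by blast
  hence fin: "finite ?S"
    using finite_incidence_edges[OF assms] by (meson finite_Pow_iff finite_imageI finite_subset)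
  have "induced_matching ?E {}"
    unfolding induced_matching_def by simp
  hence ne: "?S \<noteq> {}" by blast
  show ?thesis
  proof
    assume le: "m \<le> IM F d"
    have "IM F d \<in> ?S"
      unfolding IM_def using Max_in[OF fin ne] .
    then obtain M where M: "induced_matching ?E M" "card M = IM F d" by auto
    then obtain N where N: "N \<subseteq> M" "card N = m"
      using le by (metis obtain_subset_with_card_n)
    have "induced_matching ?E N"
      using M(1) N(1) unfolding induced_matching_def by blast
    with N show "\<exists>M. induced_matching ?E M \<and> card M = m" by blast
  next
    assume "\<exists>M. induced_matching ?E M \<and> card M = m"
    thus "m \<le> IM F d" unfolding IM_def by (intro Max_ge fin) auto
  qed
qed

lemma le_IM_iff_pairs:
  assumes "finite (carrier F)"
  shows "m \<le> IM F d \<longleftrightarrow> (\<exists>p l. (\<forall>i<m. p i \<in> points F d \<and> l i \<in> affine_lines F d) \<and>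
    (\<forall>i<m. \<forall>j<m. p i \<in> l j \<longleftrightarrow> i = j))"
proof -
  let ?E = "incidence_edges F d"
  have E_iff: "{Inl p, Inr l} \<in> ?E \<longleftrightarrow> p \<in> points F d \<and> l \<in> affine_lines F d \<and> p \<in> l" for p l
    unfolding incidence_edges_def by (auto simp: doubleton_eq_iff)
  have E_ll: "{Inl p, Inl p'} \<notin> ?E" "{Inr l, Inr l'} \<notin> ?E" for p p' l l'
    unfolding incidence_edges_def by (auto simp: doubleton_eq_iff)
  show ?thesis unfolding le_IM_iff[OF assms]
  proof
    assume "\<exists>M. induced_matching ?E M \<and> card M = m"
    then obtain M where M: "induced_matching ?E M" "card M = m" by blast
    have "M \<subseteq> ?E" using M(1) unfolding induced_matching_def by blast
    hence "finite M" using finite_incidence_edges[OF assms] finite_subset by blast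
    then obtain e where "bij_betw e {0..<m} M"
      using M(2) ex_bij_betw_nat_finite by blast
    hence e: "\<And>i. i < m \<Longrightarrow> e i \<in> M" "\<And>i j. i < m \<Longrightarrow> j < m \<Longrightarrow> e i = e j \<Longrightarrow> i = j"
      by (auto simp: bij_betw_def inj_on_def)
    have "\<exists>p l. e i = {Inl p, Inr l} \<and> p \<in> points F d \<and> l \<in> affine_lines F d \<and> p \<in> l"
      if "i < m" for i
      using e(1)[OF that] \<open>M \<subseteq> ?E\<close> unfolding incidence_edges_def by blast
    then obtain p l where pl: "\<And>i. i < m \<Longrightarrow> e i = {Inl (p i), Inr (l i)} \<and>
        p i \<in> points F d \<and> l i \<in> affine_lines F d \<and> p i \<in> l i" by metis
    have "p i \<in> l j \<longleftrightarrow> i = j" if ij: "i < m" "j < m" for i j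
    proof
      assume inc: "p i \<in> l j"
      show "i = j"
      proof (rule ccontr)
        assume "i \<noteq> j"
        hence "e i \<noteq> e j" using e(2) ij by blast
        moreover have "Inl (p i) \<in> e i" "Inr (l j) \<in> e j" using pl ij by auto
        ultimately have "{Inl (p i), Inr (l j)} \<notin> ?E"
          using M(1) e(1) ij unfolding induced_matching_def by blast
        thus False using inc pl ij E_iff by blast
      qed
    qed (use pl ij in auto)
    thus "\<exists>p l. (\<forall>i<m. p i \<in> points F d \<and> l i \<in> affine_lines F d) \<and>
      (\<forall>i<m. \<forall>j<m. p i \<in> l j \<longleftrightarrow> i = j)" using pl by blast
  next
    assume "\<exists>p l. (\<forall>i<m. p i \<in> points F d \<and> l i \<in> affine_lines F d) \<and>
      (\<forall>i<m. \<forall>j<m. p i \<in> l j \<longleftrightarrow> i = j)"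
    then obtain p l where *: "\<forall>i<m. p i \<in> points F d \<and> l i \<in> affine_lines F d"
      "\<forall>i<m. \<forall>j<m. p i \<in> l j \<longleftrightarrow> i = j" by (elim exE conjE)
    have pl: "\<And>i. i < m \<Longrightarrow> p i \<in> points F d \<and> l i \<in> affine_lines F d"
      "\<And>i j. i < m \<Longrightarrow> j < m \<Longrightarrow> p i \<in> l j \<longleftrightarrow> i = j"
      using * by simp_all
    define e where "e i = {Inl (p i), Inr (l i)}" for i
    have p_inj: "i = j" if "i < m" "j < m" "p i = p j" for i j
      using that pl(2)[of i j] pl(2)[of j j] by simp
    have l_inj: "i = j" if "i < m" "j < m" "l i = l j" for i j
      using that pl(2)[of i j] pl(2)[of i i] by simp
    have "inj_on e {..<m}"
      using p_inj unfolding e_def by (intro inj_onI) (auto simp: doubleton_eq_iff)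
    hence "card (e ` {..<m}) = m" by (simp add: card_image)
    moreover have "induced_matching ?E (e ` {..<m})"
      unfolding induced_matching_def
    proof (intro conjI ballI impI)
      show "e ` {..<m} \<subseteq> ?E" using pl by (auto simp: e_def E_iff)
    next
      fix x y assume "x \<in> e ` {..<m}" "y \<in> e ` {..<m}" "x \<noteq> y"
      then obtain i j where ij: "i < m" "j < m" "x = e i" "y = e j" "i \<noteq> j" by auto
      show "x \<inter> y = {}" using ij p_inj l_inj by (auto simp: e_def)
      fix u w assume "u \<in> x" "w \<in> y"
      hence uw: "u = Inl (p i) \<or> u = Inr (l i)" "w = Inl (p j) \<or> w = Inr (l j)"
        using ij by (auto simp: e_def)
      have "{Inl (p i), Inr (l j)} \<notin> ?E" "{Inr (l i), Inl (p j)} \<notin> ?E"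
        using ij pl(2)[of i j] pl(2)[of j i] E_iff[of "p i" "l j"] E_iff[of "p j" "l i"]
        by (simp_all add: insert_commute)
      thus "{u, w} \<notin> ?E" using uw E_ll by metis
    qed
    ultimately show "\<exists>M. induced_matching ?E M \<and> card M = m" by blast
  qed
qed

end

theory Submission
  imports Defs
begin

text \<open>Take \<open>s\<close> of order \<open>\<surd>d\<close>, an integer \<open>M\<close> of order \<open>q powr (1/s\<^sup>3)\<close> and
  \<open>B = M ^ s\<^sup>2\<close>, so that \<open>q \<le> B ^ s\<close>.  Points have integer coordinates in the short interval
  \<open>[0, q/(4M))\<close> and are grouped into \<open>s\<close> blocks, each with \<open>s + 1\<close> ladder and \<open>s + 2\<close> free
  coordinates.  In block \<open>j\<close> the direction is \<open>B ^ j M ^ i\<close> on the ladder and \<open>B ^ j w_j\<close> on the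
  free part, where \<open>w_j\<close> is a nonzero integer vector with entries at most \<open>M ^ s\<close>, almost
  orthogonal to the free part of the point (pigeonhole).  If two points of the box lie on such a
  line, then climbing the ladder shows that no reduction modulo \<open>q\<close> takes place: the free parts
  differ by exactly \<open>T_j w_j\<close> with \<open>T_j \<equiv> t B ^ j\<close>, and some \<open>T_j\<close> is at least \<open>q/(2B)\<close>.  As
  the line is nearly tangent to the sphere through the point, the sum of squares of the free
  coordinates grows by at least \<open>q\<^sup>2/(16B\<^sup>2)\<close>.  So in a spherical shell of that thickness
  each of these lines meets only its own point, and a box cut into \<open>O(B\<^sup>2)\<close> shells gives the loss
  \<open>M ^ (d + 2s\<^sup>2)\<close>, which is \<open>q powr O(1/\<surd>d)\<close>.\<close>

section \<open>Residues, pigeonhole and tangent lines\<close>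

lemma cong_imp_eq_int:
  fixes a b q :: int
  assumes "[a = b] (mod q)" "\<bar>a - b\<bar> < q"
  shows "a = b"
  using assms zdvd_imp_le[of q "\<bar>a - b\<bar>"] by (force simp: cong_iff_dvd_diff)

lemma abs_diff_less_if_div_eq:
  fixes a b q :: int
  assumes "a div q = b div q" "q > 0"
  shows "\<bar>a - b\<bar> < q"
proof -
  have "a - b = a mod q - b mod q"
    using assms(1) minus_div_mult_eq_mod[of a q] minus_div_mult_eq_mod[of b q] by simp
  thus ?thesis
    using pos_mod_bound[OF assms(2), of a] pos_mod_bound[OF assms(2), of b]
      pos_mod_sign[OF assms(2), of a] pos_mod_sign[OF assms(2), of b] by linarith
qed

text \<open>Pigeonhole over the vectors with entries in \<open>{0..W}\<close>: \<open>N\<close>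
  times the inner product with \<open>x\<close> lies between 0 and \<open>N * e * W * q\<close>, so
  its quotient by \<open>q\<close> takes at most \<open>N * e * W + 1\<close> values, fewer than
  there are vectors. The difference of two vectors sharing a quotient is the required
  \<open>w\<close>.\<close>

lemma ex_small_combination:
  fixes x :: "nat \<Rightarrow> int" and q :: int and N W e :: nat
  assumes x: "\<And>i. i < e \<Longrightarrow> 0 \<le> x i \<and> x i < q" and "q > 0"
    and big: "N * e * W + 1 < (W + 1) ^ e"
  shows "\<exists>w. (\<exists>i<e. w i \<noteq> 0) \<and> (\<forall>i<e. \<bar>w i\<bar> \<le> int W) \<and> int N * \<bar>\<Sum>i<e. x i * w i\<bar> < q"
proof -
  let ?D = "{..<e} \<rightarrow>\<^sub>E {0..int W}"
  define g where "g w = (int N * (\<Sum>i<e. x i * w i)) div q" for w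
  have "g w \<in> {0..int (N * e * W)}" if "w \<in> ?D" for w
  proof -
    have w: "0 \<le> w i \<and> w i \<le> int W" if "i < e" for i
      using \<open>w \<in> ?D\<close> that by (auto simp: PiE_iff)
    have "(\<Sum>i<e. x i * w i) \<le> (\<Sum>i<e. q * int W)"
      using x w \<open>q > 0\<close> by (intro sum_mono mult_mono) (auto simp: less_imp_le)
    hence "int N * (\<Sum>i<e. x i * w i) \<le> int (N * e * W) * q"
      using mult_left_mono[of _ _ "int N"] by (fastforce simp: algebra_simps)
    moreover have "0 \<le> (\<Sum>i<e. x i * w i)"
      using x w by (intro sum_nonneg) auto
    ultimately show ?thesis
      unfolding g_def using \<open>q > 0\<close>
      using zdiv_mono1[OF _ \<open>q > 0\<close>, of _ "int (N * e * W) * q"]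
      by (auto simp: pos_imp_zdiv_nonneg_iff simp del: of_nat_mult)
  qed
  hence sub: "g ` ?D \<subseteq> {0..int (N * e * W)}" by blast
  have "card (g ` ?D) \<le> N * e * W + 1"
    using card_mono[OF _ sub] by (simp add: nat_add_distrib del: of_nat_mult)
  also have "\<dots> < card ?D" using big by (simp add: card_PiE nat_add_distrib)
  finally have "\<not> inj_on g ?D" using card_image by force
  then obtain u v where uv: "u \<in> ?D" "v \<in> ?D" "u \<noteq> v" "g u = g v"
    unfolding inj_on_def by blast
  let ?w = "\<lambda>i. u i - v i"
  have "\<exists>i<e. ?w i \<noteq> 0"
    using uv(1,2,3) PiE_ext[of u "{..<e}" _ v] by fastforce
  moreover have "\<bar>?w i\<bar> \<le> int W" if "i < e" for i
  proof -
    have "0 \<le> u i" "u i \<le> int W" "0 \<le> v i" "v i \<le> int W"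
      using uv(1,2) that by (auto simp: PiE_iff)
    thus ?thesis by linarith
  qed
  moreover have "int N * \<bar>\<Sum>i<e. x i * ?w i\<bar> < q"
  proof -
    define a b where "a = int N * (\<Sum>i<e. x i * u i)" and "b = int N * (\<Sum>i<e. x i * v i)"
    have "a div q = b div q" using uv(4) by (simp add: g_def a_def b_def)
    hence "\<bar>a - b\<bar> < q" using \<open>q > 0\<close> by (rule abs_diff_less_if_div_eq)
    moreover have "a - b = int N * (\<Sum>i<e. x i * ?w i)"
      by (simp add: a_def b_def right_diff_distrib sum_subtractf)
    ultimately show ?thesis by (simp add: abs_mult)
  qed
  ultimately show ?thesis by (intro exI[of _ ?w]) simp
qed

text \<open>Matching each point of \<open>P\<close> with a line that meets \<open>P\<close> only
  there excludes every cross incidence. It therefore suffices to construct a large point set with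
  such tangent lines.\<close>

lemma card_le_IM:
  assumes "finite (carrier F)" and P: "P \<subseteq> points F d"
    and tangent: "\<And>p. p \<in> P \<Longrightarrow> \<exists>l\<in>affine_lines F d. l \<inter> P = {p}"
  shows "card P \<le> IM F d"
proof -
  have "finite (points F d)"
    unfolding points_def using assms(1) by (intro finite_PiE) auto
  hence "finite P" using P finite_subset by blast
  then obtain p where p: "bij_betw p {0..<card P} P"
    using ex_bij_betw_nat_finite by blast
  hence pP: "p i \<in> P" if "i < card P" for i
    using that by (auto simp: bij_betw_def)
  obtain L where L: "\<And>p. p \<in> P \<Longrightarrow> L p \<in> affine_lines F d \<and> L p \<inter> P = {p}"
    using tangent by metis
  have "p i \<in> L (p j) \<longleftrightarrow> i = j" if "i < card P" "j < card P" for i j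
  proof -
    have "p i \<in> L (p j) \<longleftrightarrow> p i = p j" using L[OF pP] pP that by blast
    also have "\<dots> \<longleftrightarrow> i = j"
      using p that by (auto simp: bij_betw_def inj_on_def)
    finally show ?thesis .
  qed
  thus ?thesis
    unfolding le_IM_iff_pairs[OF assms(1)]
    using pP P L by (intro exI[of _ p] exI[of _ "\<lambda>j. L (p j)"]) blast
qed

section \<open>Separation of two points on a common line\<close>

text \<open>If every \<open>T j\<close> were below \<open>q / (2 * B)\<close>, multiplication by
  \<open>B\<close> would never wrap around modulo \<open>q\<close>, so
  \<open>T j = B ^ j * T 0\<close> would hold over the integers. As \<open>T 0\<close> is congruent
  to \<open>t\<close>, it is nonzero, and the last digit would satisfy
  \<open>B * \<bar>T (s - 1)\<bar> \<ge> B ^ s \<ge> q\<close>, a contradiction.\<close>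

lemma ex_large_digit:
  fixes T :: "nat \<Rightarrow> int" and B q t :: int
  assumes "B \<ge> 1" "s \<ge> 1" "q \<le> B ^ s"
    and T: "\<And>j. j < s \<Longrightarrow> [T j = t * B ^ j] (mod q)"
    and small: "\<And>j. j < s \<Longrightarrow> 2 * \<bar>T j\<bar> < q"
    and t: "\<not> q dvd t"
  shows "\<exists>j<s. q \<le> 2 * B * \<bar>T j\<bar>"
proof (rule ccontr)
  assume neg: "\<not> ?thesis"
  have power: "T j = B ^ j * T 0" if "j < s" for j
    using that
  proof (induction j)
    case (Suc j)
    have "[T (Suc j) = B * T j] (mod q)"
      using T[of "Suc j"] cong_scalar_left[OF T[of j], of B] Suc.prems
      by (metis Suc_lessD cong_sym cong_trans mult.left_commute power_Suc)
    moreover have "2 * B * \<bar>T j\<bar> < q" using neg Suc.prems by (meson Suc_lessD not_le)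
    hence "2 * \<bar>B * T j\<bar> < q" using \<open>B \<ge> 1\<close> by (simp add: abs_mult)
    hence "\<bar>T (Suc j) - B * T j\<bar> < q" using small[OF Suc.prems] by linarith
    ultimately have "T (Suc j) = B * T j" by (rule cong_imp_eq_int)
    thus ?case using Suc by simp
  qed simp
  have "T 0 \<noteq> 0"
    using T[of 0] t \<open>s \<ge> 1\<close> by (auto simp: cong_0_iff dest: cong_sym)
  hence "B ^ (s - 1) * 1 \<le> B ^ (s - 1) * \<bar>T 0\<bar>"
    using \<open>B \<ge> 1\<close> by (intro mult_left_mono) auto
  also have "\<dots> = \<bar>T (s - 1)\<bar>"
    using power[of "s - 1"] \<open>s \<ge> 1\<close> \<open>B \<ge> 1\<close> by (simp add: abs_mult)
  finally have "B * B ^ (s - 1) \<le> B * \<bar>T (s - 1)\<bar>"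
    using \<open>B \<ge> 1\<close> by (intro mult_left_mono) auto
  moreover have "B * B ^ (s - 1) = B ^ s"
    using \<open>s \<ge> 1\<close> by (cases s) auto
  moreover have "2 * B * \<bar>T (s - 1)\<bar> < q"
  proof -
    have "s - 1 < s" using \<open>s \<ge> 1\<close> by simp
    thus ?thesis using neg by (meson not_le)
  qed
  moreover have "0 \<le> B * \<bar>T (s - 1)\<bar>" using \<open>B \<ge> 1\<close> by simp
  ultimately show False using \<open>q \<le> B ^ s\<close> by linarith
qed

text \<open>Completing the square, each term is at least \<open>- (a j)\<^sup>2\<close>, so the
  terms other than \<open>j0\<close> lose at most \<open>q\<^sup>2 / 64\<close> in total. The term
  \<open>j0\<close> contributes at least \<open>q/2 * q/4\<close>, and 1/8 - 1/64 exceeds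
  1/16.\<close>

lemma sum_quadratic_lower_bound:
  fixes u a :: "nat \<Rightarrow> real" and q :: real
  assumes a: "\<And>j. j < s \<Longrightarrow> 8 * real s * \<bar>a j\<bar> \<le> q"
    and "j0 < s" "q \<le> 2 * \<bar>u j0\<bar>" "q > 0"
  shows "q\<^sup>2 \<le> 16 * (\<Sum>j<s. (u j)\<^sup>2 + 2 * a j * u j)"
proof -
  have s: "real s \<ge> 1" using \<open>j0 < s\<close> by simp
  have low: "- (q\<^sup>2 / (64 * (real s)\<^sup>2)) \<le> (u j)\<^sup>2 + 2 * a j * u j" if "j < s" for j
  proof -
    have "\<bar>a j\<bar> \<le> q / (8 * real s)" using a[OF that] s by (simp add: field_simps)
    hence "(a j)\<^sup>2 \<le> (q / (8 * real s))\<^sup>2" by (metis abs_ge_zero power2_abs power_mono)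
    moreover have "0 \<le> (u j + a j)\<^sup>2" by simp
    ultimately show ?thesis by (simp add: power2_sum power_divide power_mult_distrib algebra_simps)
  qed
  have "8 * \<bar>a j0\<bar> \<le> 8 * real s * \<bar>a j0\<bar>"
    using s by (simp add: mult_le_cancel_right1)
  hence a0: "8 * \<bar>a j0\<bar> \<le> q" using a[OF \<open>j0 < s\<close>] by linarith
  have "q / 2 * (q / 4) \<le> \<bar>u j0\<bar> * (\<bar>u j0\<bar> - 2 * \<bar>a j0\<bar>)"
    using assms(3,4) a0 by (intro mult_mono) auto
  also have "\<dots> \<le> (u j0)\<^sup>2 + 2 * a j0 * u j0"
  proof -
    have "- (\<bar>a j0\<bar> * \<bar>u j0\<bar>) \<le> a j0 * u j0" by (metis abs_ge_minus_self abs_mult neg_le_iff_le minus_minus)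
    thus ?thesis by (simp add: algebra_simps power2_eq_square)
  qed
  finally have main: "q\<^sup>2 / 8 \<le> (u j0)\<^sup>2 + 2 * a j0 * u j0" by (simp add: power2_eq_square)
  have "- (q\<^sup>2 / 64) \<le> (\<Sum>j\<in>{..<s}-{j0}. - (q\<^sup>2 / (64 * (real s)\<^sup>2)))"
  proof -
    have "real (card ({..<s} - {j0})) \<le> real s"
      by (metis card_Diff1_le card_lessThan finite_lessThan of_nat_le_iff)
    also have "\<dots> \<le> (real s)\<^sup>2"
      using s by (simp add: power2_eq_square)
    finally have "real (card ({..<s} - {j0})) * (q\<^sup>2 / (64 * (real s)\<^sup>2))
        \<le> (real s)\<^sup>2 * (q\<^sup>2 / (64 * (real s)\<^sup>2))"
      by (intro mult_right_mono) auto
    also have "\<dots> = q\<^sup>2 / 64" using s by (simp add: field_simps)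
    finally show ?thesis by simp
  qed
  also have "\<dots> \<le> (\<Sum>j\<in>{..<s}-{j0}. (u j)\<^sup>2 + 2 * a j * u j)"
    using low by (intro sum_mono) auto
  finally have "- (q\<^sup>2 / 64) \<le> (\<Sum>j\<in>{..<s}-{j0}. (u j)\<^sup>2 + 2 * a j * u j)" .
  moreover have "(\<Sum>j<s. (u j)\<^sup>2 + 2 * a j * u j)
      = (u j0)\<^sup>2 + 2 * a j0 * u j0 + (\<Sum>j\<in>{..<s}-{j0}. (u j)\<^sup>2 + 2 * a j * u j)"
    using \<open>j0 < s\<close> by (intro sum.remove) auto
  moreover have "q\<^sup>2 \<ge> 0" by simp
  ultimately show ?thesis using main by linarith
qed

text \<open>Primed coordinates belong to a second point, reached from the first with line parameter
  \<open>t\<close>; \<open>r\<close> is the top exponent of the ladder and \<open>e\<close> the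
  number of free coordinates per block. A parameter not divisible by \<open>q\<close> changes the
  sum of squares by at least \<open>q\<^sup>2 / (16 * B\<^sup>2)\<close>, which \<open>close\<close>
  forbids.\<close>

lemma separation:
  fixes q M B t :: int and y y' x x' w :: "nat \<Rightarrow> nat \<Rightarrow> int"
  assumes "q > 0" "M \<ge> 1" "B \<ge> 1" "s \<ge> 1" "q \<le> B ^ s"
    and ladder: "\<And>j i. j < s \<Longrightarrow> i \<le> r \<Longrightarrow> [y' j i = y j i + t * (B ^ j * M ^ i)] (mod q)"
    and y_box: "\<And>j i. j < s \<Longrightarrow> i \<le> r \<Longrightarrow> 4 * M * \<bar>y' j i - y j i\<bar> < q"
    and free: "\<And>j i. j < s \<Longrightarrow> i < e \<Longrightarrow> [x' j i = x j i + t * (B ^ j * w j i)] (mod q)"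
    and x_box: "\<And>j i. j < s \<Longrightarrow> i < e \<Longrightarrow> 4 * M * \<bar>x' j i - x j i\<bar> < q"
    and w_le: "\<And>j i. j < s \<Longrightarrow> i < e \<Longrightarrow> \<bar>w j i\<bar> \<le> M ^ r"
    and w_nz: "\<And>j. j < s \<Longrightarrow> \<exists>i<e. w j i \<noteq> 0"
    and orth: "\<And>j. j < s \<Longrightarrow> 8 * int s * B * \<bar>\<Sum>i<e. x j i * w j i\<bar> < q"
    and close: "16 * B\<^sup>2 * \<bar>(\<Sum>j<s. \<Sum>i<e. (x' j i)\<^sup>2) - (\<Sum>j<s. \<Sum>i<e. (x j i)\<^sup>2)\<bar> < q\<^sup>2"
  shows "q dvd t"
proof (rule ccontr)
  assume t: "\<not> q dvd t"
  define T where "T j = y' j 0 - y j 0" for j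
  define A where "A j = (\<Sum>i<e. x j i * w j i)" for j
  have le4: "4 * \<bar>z\<bar> < q" if "4 * M * \<bar>z\<bar> < q" for z
    using that mult_right_mono[of 1 M "\<bar>z\<bar>"] \<open>M \<ge> 1\<close> by linarith
  have near: "\<bar>b - a\<bar> < q" if "4 * \<bar>a\<bar> < q" "4 * \<bar>b\<bar> < q" for a b :: int
    using that by linarith
  have T: "[T j = t * B ^ j] (mod q)" if "j < s" for j
    using ladder[OF that, of 0] cong_diff[OF ladder[OF that, of 0] cong_refl[of "y j 0" q]]
    by (simp add: T_def)
  \<comment> \<open>The factor \<open>M\<close> in the bound is the room for one more rung:
    \<open>T j * M ^ Suc i\<close> is still below \<open>q / 4\<close>, so it equals the coordinate
    difference it is congruent to. The box condition on that difference then restores the factor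
    \<open>M\<close>.\<close>
  have T_ladder: "4 * M * \<bar>T j * M ^ i\<bar> < q" if "j < s" "i \<le> r" for j i
    using that(2)
  proof (induction i)
    case 0
    thus ?case using y_box[OF that(1), of 0] by (simp add: T_def)
  next
    case (Suc i)
    let ?\<Delta> = "y' j (Suc i) - y j (Suc i)"
    have "[?\<Delta> = t * (B ^ j * M ^ Suc i)] (mod q)"
      using cong_diff[OF ladder[OF that(1) Suc.prems] cong_refl[of "y j (Suc i)" q]] by simp
    moreover have "[T j * M ^ Suc i = t * (B ^ j * M ^ Suc i)] (mod q)"
      using cong_scalar_right[OF T[OF that(1)], of "M ^ Suc i"] by (simp add: mult_ac)
    ultimately have "[?\<Delta> = T j * M ^ Suc i] (mod q)"
      by (metis cong_sym cong_trans)
    moreover have "4 * \<bar>T j * M ^ Suc i\<bar> < q"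
      using Suc \<open>M \<ge> 1\<close> by (simp add: abs_mult mult_ac)
    hence "\<bar>?\<Delta> - T j * M ^ Suc i\<bar> < q"
      using le4[OF y_box[OF that(1) Suc.prems]] by (rule near)
    ultimately have "?\<Delta> = T j * M ^ Suc i" by (rule cong_imp_eq_int)
    thus ?case using y_box[OF that(1) Suc.prems] by simp
  qed
  \<comment> \<open>Since the entries of \<open>w j\<close> are at most \<open>M ^ r\<close>, the
    product \<open>T j * w j i\<close> is no larger than the top rung of the ladder, and again the
    congruence is an equality.\<close>
  have step: "x' j i = x j i + T j * w j i" if "j < s" "i < e" for j i
  proof -
    let ?\<Delta> = "x' j i - x j i"
    have "[?\<Delta> = t * (B ^ j * w j i)] (mod q)"
      using cong_diff[OF free[OF that] cong_refl[of "x j i" q]] by simp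
    moreover have "[T j * w j i = t * (B ^ j * w j i)] (mod q)"
      using cong_scalar_right[OF T[OF that(1)], of "w j i"] by (simp add: mult_ac)
    ultimately have "[?\<Delta> = T j * w j i] (mod q)"
      by (metis cong_sym cong_trans)
    moreover have "4 * \<bar>T j * w j i\<bar> \<le> 4 * \<bar>T j * M ^ r\<bar>"
      using w_le[OF that] \<open>M \<ge> 1\<close> by (simp add: abs_mult mult_left_mono)
    hence "4 * \<bar>T j * w j i\<bar> < q"
      using le4[OF T_ladder[OF that(1) order_refl]] by (rule le_less_trans)
    hence "\<bar>?\<Delta> - T j * w j i\<bar> < q"
      using le4[OF x_box[OF that]] by (rule near)
    ultimately have "?\<Delta> = T j * w j i" by (rule cong_imp_eq_int)
    thus ?thesis by simp
  qed
  have "2 * \<bar>T j\<bar> < q" if "j < s" for j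
    using le4[OF T_ladder[OF that, of 0]] by simp
  then obtain j0 where j0: "j0 < s" "q \<le> 2 * B * \<bar>T j0\<bar>"
    using ex_large_digit[of B s q T t] assms(3-5) T t by blast
  \<comment> \<open>Block \<open>j\<close> gains \<open>2 * T j * A j\<close> plus
    \<open>(T j)\<^sup>2\<close> times the squared length of \<open>w j\<close>; that length is at
    least 1 because \<open>w j\<close> is a nonzero integer vector.\<close>
  have "(\<Sum>j<s. (T j)\<^sup>2 + 2 * A j * T j) \<le> (\<Sum>j<s. (\<Sum>i<e. (x' j i)\<^sup>2) - (\<Sum>i<e. (x j i)\<^sup>2))"
  proof (rule sum_mono)
    fix j assume "j \<in> {..<s}"
    hence j: "j < s" by simp
    obtain i where i: "i < e" "w j i \<noteq> 0" using w_nz[OF j] by blast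
    have "1 \<le> (w j i)\<^sup>2" using i(2) by (simp add: int_one_le_iff_zero_less)
    also have "\<dots> \<le> (\<Sum>i<e. (w j i)\<^sup>2)"
      using i(1) member_le_sum[of i "{..<e}" "\<lambda>i. (w j i)\<^sup>2"] by simp
    finally have "(T j)\<^sup>2 * 1 \<le> (T j)\<^sup>2 * (\<Sum>i<e. (w j i)\<^sup>2)"
      by (intro mult_left_mono) auto
    moreover have "(\<Sum>i<e. (x' j i)\<^sup>2) = (\<Sum>i<e. (x j i)\<^sup>2 + 2 * T j * (x j i * w j i) + (T j)\<^sup>2 * (w j i)\<^sup>2)"
      using step[OF j] by (intro sum.cong) (auto simp: power2_eq_square algebra_simps)
    hence "(\<Sum>i<e. (x' j i)\<^sup>2) = (\<Sum>i<e. (x j i)\<^sup>2) + 2 * T j * A j + (T j)\<^sup>2 * (\<Sum>i<e. (w j i)\<^sup>2)"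
      by (simp add: sum.distrib A_def sum_distrib_left)
    ultimately show "(T j)\<^sup>2 + 2 * A j * T j \<le> (\<Sum>i<e. (x' j i)\<^sup>2) - (\<Sum>i<e. (x j i)\<^sup>2)"
      by (simp add: mult_ac)
  qed
  also have "\<dots> \<le> \<bar>(\<Sum>j<s. \<Sum>i<e. (x' j i)\<^sup>2) - (\<Sum>j<s. \<Sum>i<e. (x j i)\<^sup>2)\<bar>"
    by (simp add: sum_subtractf)
  finally have "16 * B\<^sup>2 * (\<Sum>j<s. (T j)\<^sup>2 + 2 * A j * T j)
      \<le> 16 * B\<^sup>2 * \<bar>(\<Sum>j<s. \<Sum>i<e. (x' j i)\<^sup>2) - (\<Sum>j<s. \<Sum>i<e. (x j i)\<^sup>2)\<bar>"
    by (intro mult_left_mono) auto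
  \<comment> \<open>Scaling by \<open>B\<^sup>2\<close> prepares the quadratic bound with
    \<open>u j = B * T j\<close> and \<open>a j = B * A j\<close>: \<open>orth\<close> makes every
    \<open>a j\<close> small, and the large digit \<open>j0\<close> makes \<open>u j0\<close> at
    least \<open>q / 2\<close> in absolute value.\<close>
  hence less: "16 * (\<Sum>j<s. (B * T j)\<^sup>2 + 2 * (B * A j) * (B * T j)) < q\<^sup>2"
    using close by (simp add: sum_distrib_left algebra_simps power2_eq_square)
  have "(real_of_int q)\<^sup>2 \<le> 16 * (\<Sum>j<s. (real_of_int (B * T j))\<^sup>2
      + 2 * real_of_int (B * A j) * real_of_int (B * T j))"
  proof (rule sum_quadratic_lower_bound[where ?j0.0 = j0])
    fix j assume "j < s"
    hence "8 * int s * \<bar>B * A j\<bar> \<le> q"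
      using orth[of j] \<open>B \<ge> 1\<close> by (simp add: A_def abs_mult mult_ac)
    thus "8 * real s * \<bar>real_of_int (B * A j)\<bar> \<le> real_of_int q"
      by (metis (mono_tags, lifting) of_int_abs of_int_le_iff of_int_mult of_int_numeral of_int_of_nat_eq)
  next
    have "q \<le> 2 * \<bar>B * T j0\<bar>" using j0(2) \<open>B \<ge> 1\<close> by (simp add: abs_mult mult_ac)
    thus "real_of_int q \<le> 2 * \<bar>real_of_int (B * T j0)\<bar>"
      by (metis (mono_tags, lifting) of_int_abs of_int_le_iff of_int_mult of_int_numeral)
  qed (use j0(1) \<open>q > 0\<close> in auto)
  also have "\<dots> = real_of_int (16 * (\<Sum>j<s. (B * T j)\<^sup>2 + 2 * (B * A j) * (B * T j)))"
    by simp
  finally have "real_of_int (q\<^sup>2) \<le> real_of_int (16 * (\<Sum>j<s. (B * T j)\<^sup>2 + 2 * (B * A j) * (B * T j)))"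
    by simp
  thus False using less by linarith
qed

section \<open>The box of short vectors and its spherical shells\<close>

text \<open>The box is partitioned into shells according to the sum of squares of the free
  coordinates. Inside one shell every point has a tangent line, so a shell holds at most
  \<open>IM\<close> points; the first factor on the right counts the shells.\<close>

lemma card_box_le_IM:
  fixes q M s d :: nat
  assumes "q \<ge> 2" "s \<ge> 1" and M: "8 * s * (s + 2) + 1 \<le> M"
    and q_le: "q \<le> M ^ s ^ 3" and d: "s * (2 * s + 3) \<le> d"
  shows "card {x::int. 0 \<le> x \<and> 4 * int M * x < int q} ^ d
    \<le> (16 * M ^ (2 * s\<^sup>2) * (s * (s + 2)) + 1) * IM (residue_ring (int q)) d"
proof -
  define B where "B = M ^ s\<^sup>2"
  \<comment> \<open>A block consists of \<open>s + 1\<close> ladder coordinates followed by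
    \<open>s + 2\<close> free ones, so the free coordinate \<open>i\<close> of block
    \<open>j\<close> has index \<open>j * n + s + 1 + i\<close>.\<close>
  define n where "n = 2 * s + 3"
  define S where "S = {x::int. 0 \<le> x \<and> 4 * int M * x < int q}"
  define Box where "Box = {..<d} \<rightarrow>\<^sub>E S"
  define f where "f p = (\<Sum>j<s. \<Sum>i<s+2. (p (j * n + s + 1 + i))\<^sup>2)" for p :: "nat \<Rightarrow> int"
  \<comment> \<open>Shells have thickness \<open>q\<^sup>2 / (16 * B\<^sup>2)\<close>, exactly the
    growth that \<open>separation\<close> rules out between two points of one shell.\<close>
  define cell where "cell p = (16 * (int B)\<^sup>2 * f p) div (int q)\<^sup>2" for p
  define cells where "cells = {0..int (16 * B\<^sup>2 * (s * (s + 2)))}"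
  define R where "R = residue_ring (int q)"
  have "M \<ge> 1" using M by simp
  have "B \<ge> 1" unfolding B_def using \<open>M \<ge> 1\<close> by simp
  have idx: "j * n + i < d" "j * n + i < s * n" if "j < s" "i < n" for j i
  proof -
    have "j * n + i < Suc j * n" using that by simp
    also have "\<dots> \<le> s * n" using that by (intro mult_right_mono) auto
    finally show "j * n + i < s * n" .
    thus "j * n + i < d" using d by (simp add: n_def)
  qed
  have S_less: "0 \<le> x \<and> x < int q" if "x \<in> S" for x
  proof -
    have "1 * x \<le> 4 * int M * x"
      using that \<open>M \<ge> 1\<close> by (intro mult_right_mono) (auto simp: S_def)
    thus ?thesis using that by (auto simp: S_def)
  qed
  have "S \<subseteq> {0..<int q}" using S_less by auto
  hence "finite S" using finite_subset by blast
  hence "finite Box" unfolding Box_def by (intro finite_PiE) auto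
  have "finite (carrier R)" by (simp add: R_def residue_ring_def)
  have Box_S: "p i \<in> S" if "p \<in> Box" "i < d" for p i
    using that by (auto simp: Box_def PiE_iff)
  have diff: "4 * int M * \<bar>x' - x\<bar> < int q" if "x \<in> S" "x' \<in> S" for x x'
  proof -
    have "4 * int M * (x' - x) \<le> 4 * int M * x'" "4 * int M * (x - x') \<le> 4 * int M * x"
      using that \<open>M \<ge> 1\<close> by (auto intro!: mult_left_mono simp: S_def)
    thus ?thesis using that by (auto simp: S_def abs_if)
  qed
  have cells: "cell p \<in> cells" if "p \<in> Box" for p
  proof -
    have "f p \<le> (\<Sum>j<s. \<Sum>i<s+2. (int q)\<^sup>2)"
      unfolding f_def
    proof (intro sum_mono)
      fix j i assume "j \<in> {..<s}" "i \<in> {..<s+2}"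
      hence "j * n + (s + 1 + i) < d" by (intro idx) (auto simp: n_def)
      hence "p (j * n + s + 1 + i) \<in> S" using Box_S[OF that] by (simp add: add_ac)
      thus "(p (j * n + s + 1 + i))\<^sup>2 \<le> (int q)\<^sup>2"
        using S_less by (intro power_mono) (auto simp: less_imp_le)
    qed
    also have "\<dots> = int (s * (s + 2)) * (int q)\<^sup>2" by (simp add: algebra_simps)
    finally have "16 * (int B)\<^sup>2 * f p \<le> 16 * (int B)\<^sup>2 * (int (s * (s + 2)) * (int q)\<^sup>2)"
      by (intro mult_left_mono) auto
    also have "\<dots> = int (16 * B\<^sup>2 * (s * (s + 2))) * (int q)\<^sup>2" by simp
    finally have "cell p \<le> int (16 * B\<^sup>2 * (s * (s + 2))) * (int q)\<^sup>2 div (int q)\<^sup>2"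
      unfolding cell_def using \<open>q \<ge> 2\<close> by (intro zdiv_mono1) auto
    moreover have "0 \<le> f p" unfolding f_def by (intro sum_nonneg) auto
    hence "0 \<le> cell p"
      unfolding cell_def using \<open>q \<ge> 2\<close> by (simp add: pos_imp_zdiv_nonneg_iff)
    ultimately show ?thesis using \<open>q \<ge> 2\<close> by (auto simp: cells_def simp del: of_nat_mult)
  qed
  \<comment> \<open>One factor \<open>M\<close> absorbs the constant
    \<open>8 * s * (s + 2) + 1\<close>, leaving the exponent \<open>s\<^sup>2 + s + 1\<close> to be
    beaten by \<open>s * e\<close>. This is why a block has \<open>e = s + 2\<close> free
    coordinates; \<open>s + 1\<close> would fall short by one.\<close>
  have big: "8 * s * B * (s + 2) * M ^ s + 1 < (M ^ s + 1) ^ (s + 2)"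
  proof -
    have "8 * s * B * (s + 2) * M ^ s + 1 \<le> 8 * s * (s + 2) * (B * M ^ s) + B * M ^ s"
      using \<open>B \<ge> 1\<close> \<open>M \<ge> 1\<close> by (simp add: algebra_simps)
    also have "\<dots> = (8 * s * (s + 2) + 1) * (B * M ^ s)" by (simp add: algebra_simps)
    also have "\<dots> \<le> M * (B * M ^ s)" using M by (rule mult_right_mono) simp
    also have "\<dots> = M ^ (s\<^sup>2 + s + 1)" by (simp add: B_def power_add mult_ac)
    also have "\<dots> \<le> M ^ (s * (s + 2))"
      using \<open>M \<ge> 1\<close> \<open>s \<ge> 1\<close> by (intro power_increasing) (auto simp: power2_eq_square)
    also have "\<dots> = (M ^ s) ^ (s + 2)" by (rule power_mult)
    also have "\<dots> < (M ^ s + 1) ^ (s + 2)" by (intro power_strict_mono) auto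
    finally show ?thesis .
  qed
  have Box_points: "Box \<subseteq> points R d"
    unfolding Box_def points_def using S_less
    by (intro PiE_mono) (auto simp: R_def residue_ring_def)
  have fiber: "card {p \<in> Box. cell p = c} \<le> IM R d" for c
  proof (rule card_le_IM[OF \<open>finite (carrier R)\<close>])
    show "{p \<in> Box. cell p = c} \<subseteq> points R d" using Box_points by blast
  next
    fix p assume "p \<in> {p \<in> Box. cell p = c}"
    hence p: "p \<in> Box" "cell p = c" by auto
    \<comment> \<open>The factor \<open>8 * s * B\<close> and the entry bound \<open>M ^ s\<close>
      are those of \<open>orth\<close> and \<open>w_le\<close> in \<open>separation\<close>.\<close>
    define short where "short j w \<longleftrightarrow> (\<exists>i<s+2. w i \<noteq> 0) \<and> (\<forall>i<s+2. \<bar>w i\<bar> \<le> int (M ^ s)) \<and>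
        int (8 * s * B) * \<bar>\<Sum>i<s+2. p (j * n + s + 1 + i) * w i\<bar> < int q" for j w
    have "\<exists>w. short j w" if "j < s" for j
      unfolding short_def
    proof (rule ex_small_combination[OF _ _ big])
      fix i assume "i < s + 2"
      hence "j * n + (s + 1 + i) < d" by (intro idx that) (auto simp: n_def)
      thus "0 \<le> p (j * n + s + 1 + i) \<and> p (j * n + s + 1 + i) < int q"
        using Box_S[OF p(1)] S_less by (simp add: add_ac)
    qed (use \<open>q \<ge> 2\<close> in simp)
    then obtain w where w: "\<And>j. j < s \<Longrightarrow> short j (w j)" by metis
    define u where "u j i = int B ^ j * (if i \<le> s then int M ^ i else w j (i - (s + 1)))" for j i
    \<comment> \<open>At indices from \<open>s * n\<close> on the entries may involve unspecified
      \<open>w j\<close> with \<open>j \<ge> s\<close>. Any residues will do there, because the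
      first \<open>s\<close> blocks already force the line parameter to be 0.\<close>
    define v where "v = (\<lambda>k\<in>{..<d}. u (k div n) (k mod n) mod int q)"
    define l where "l = line_through R d p v"
    have v_points: "v \<in> points R d"
      using \<open>q \<ge> 2\<close> by (auto simp: v_def points_def R_def residue_ring_def)
    have "d > 0" using idx[of 0 0] \<open>s \<ge> 1\<close> by (simp add: n_def)
    \<comment> \<open>The lowest rung of block 0 is \<open>B ^ 0 * M ^ 0\<close>, which makes the
      direction nonzero.\<close>
    hence "v 0 = 1" using \<open>q \<ge> 2\<close> by (simp add: v_def u_def)
    hence "\<exists>i<d. v i \<noteq> \<zero>\<^bsub>R\<^esub>"
      using \<open>d > 0\<close> by (auto simp: R_def residue_ring_def intro!: exI[of _ 0])
    moreover have p_points: "p \<in> points R d"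
      using p(1) Box_points by blast
    ultimately have l: "l \<in> affine_lines R d"
      using v_points by (auto simp: affine_lines_def l_def)
    have at0: "(\<lambda>i\<in>{..<d}. p i \<oplus>\<^bsub>R\<^esub> 0 \<otimes>\<^bsub>R\<^esub> v i) = p"
    proof
      fix i show "(\<lambda>i\<in>{..<d}. p i \<oplus>\<^bsub>R\<^esub> 0 \<otimes>\<^bsub>R\<^esub> v i) i = p i"
        using p(1) Box_S[OF p(1), of i] S_less[of "p i"]
        by (cases "i < d") (auto simp: R_def residue_ring_def Box_def PiE_iff extensional_def)
    qed
    have "0 \<in> carrier R" using \<open>q \<ge> 2\<close> by (simp add: R_def residue_ring_def)
    hence "p \<in> l"
      unfolding l_def line_through_def by (intro image_eqI[of _ _ 0]) (simp_all only: at0)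
    moreover have "p' = p" if p': "p' \<in> Box" "cell p' = c" "p' \<in> l" for p'
    proof -
      obtain t where t: "t \<in> carrier R" "p' = (\<lambda>i\<in>{..<d}. p i \<oplus>\<^bsub>R\<^esub> t \<otimes>\<^bsub>R\<^esub> v i)"
        using p'(3) by (auto simp: l_def line_through_def)
      have cong: "[p' (j * n + i) = p (j * n + i) + t * u j i] (mod int q)" if "j < s" "i < n" for j i
      proof -
        have "p' (j * n + i) = (p (j * n + i) + t * (u j i mod int q) mod int q) mod int q"
          using t(2) idx[OF that] that(2) by (simp add: R_def residue_ring_def v_def)
        thus ?thesis by (simp add: cong_def mod_simps)
      qed
      have box: "4 * int M * \<bar>p' (j * n + i) - p (j * n + i)\<bar> < int q" if "j < s" "i < n" for j i
        using Box_S[OF p(1) idx(1)[OF that]] Box_S[OF p'(1) idx(1)[OF that]] by (rule diff)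
      have "int q dvd t"
      proof (rule separation[where M = "int M" and B = "int B" and s = s and r = s and e = "s + 2"
            and y = "\<lambda>j i. p (j * n + i)" and y' = "\<lambda>j i. p' (j * n + i)"
            and x = "\<lambda>j i. p (j * n + s + 1 + i)" and x' = "\<lambda>j i. p' (j * n + s + 1 + i)"
            and w = w])
        have "B ^ s = M ^ s ^ 3"
          by (simp add: B_def power_mult[symmetric] power2_eq_square power3_eq_cube)
        thus "int q \<le> int B ^ s" using q_le by (metis of_nat_le_iff of_nat_power)
      next
        fix j i assume "j < s" "i \<le> s"
        thus "[p' (j * n + i) = p (j * n + i) + t * (int B ^ j * int M ^ i)] (mod int q)"
          using cong[of j i] by (simp add: u_def n_def)
      next
        fix j i assume "j < s" "i < s + 2"
        thus "[p' (j * n + s + 1 + i) = p (j * n + s + 1 + i) + t * (int B ^ j * w j i)] (mod int q)"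
          using cong[of j "s + 1 + i"] by (simp add: u_def n_def add_ac)
      next
        fix j i assume "j < s" "i < s + 2"
        thus "4 * int M * \<bar>p' (j * n + s + 1 + i) - p (j * n + s + 1 + i)\<bar> < int q"
          using box[of j "s + 1 + i"] by (simp add: n_def add_ac)
      next
        fix j assume "j < s"
        show "8 * int s * int B * \<bar>\<Sum>i<s+2. p (j * n + s + 1 + i) * w j i\<bar> < int q"
          using w[OF \<open>j < s\<close>] by (simp add: short_def)
        show "\<exists>i<s+2. w j i \<noteq> 0"
          using w[OF \<open>j < s\<close>] by (simp add: short_def)
        fix i assume "i < s + 2"
        thus "\<bar>w j i\<bar> \<le> int M ^ s"
          using w[OF \<open>j < s\<close>] by (simp add: short_def)
      next
        define a b where "a = 16 * (int B)\<^sup>2 * f p'" and "b = 16 * (int B)\<^sup>2 * f p"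
        have "(int q)\<^sup>2 > 0" using \<open>q \<ge> 2\<close> by simp
        have "a div (int q)\<^sup>2 = b div (int q)\<^sup>2"
          using p(2) p'(2) by (simp add: cell_def a_def b_def)
        hence "\<bar>a - b\<bar> < (int q)\<^sup>2"
          using \<open>(int q)\<^sup>2 > 0\<close> by (rule abs_diff_less_if_div_eq)
        moreover have "a - b = 16 * (int B)\<^sup>2 * (f p' - f p)"
          by (simp add: a_def b_def right_diff_distrib)
        ultimately show "16 * (int B)\<^sup>2 * \<bar>(\<Sum>j<s. \<Sum>i<s+2. (p' (j * n + s + 1 + i))\<^sup>2)
            - (\<Sum>j<s. \<Sum>i<s+2. (p (j * n + s + 1 + i))\<^sup>2)\<bar> < (int q)\<^sup>2"
          by (simp only: abs_mult f_def[symmetric]) simp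
      qed (use \<open>q \<ge> 2\<close> \<open>M \<ge> 1\<close> \<open>B \<ge> 1\<close> \<open>s \<ge> 1\<close> box in \<open>auto simp: n_def\<close>)
      hence "t = 0"
        using t(1) zdvd_imp_le[of "int q" t] by (force simp: R_def residue_ring_def)
      thus ?thesis using t(2) at0 by simp
    qed
    ultimately have "l \<inter> {p \<in> Box. cell p = c} = {p}" using p by blast
    thus "\<exists>l\<in>affine_lines R d. l \<inter> {p \<in> Box. cell p = c} = {p}" using l by blast
  qed
  have "Box = (\<Union>c\<in>cells. {p \<in> Box. cell p = c})" using cells by blast
  moreover have "card (\<Union>c\<in>cells. {p \<in> Box. cell p = c}) \<le> (\<Sum>c\<in>cells. card {p \<in> Box. cell p = c})"
    by (rule card_UN_le) (simp add: cells_def)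
  ultimately have "card Box \<le> (\<Sum>c\<in>cells. card {p \<in> Box. cell p = c})" by simp
  also have "\<dots> \<le> card cells * IM R d"
    using sum_bounded_above[of cells "\<lambda>c. card {p \<in> Box. cell p = c}"] fiber by simp
  also have "card cells = 16 * M ^ (2 * s\<^sup>2) * (s * (s + 2)) + 1"
    by (simp add: cells_def B_def power_mult[symmetric] mult.commute nat_add_distrib del: of_nat_mult)
  finally show ?thesis by (simp add: Box_def S_def R_def card_PiE)
qed

section \<open>Choice of parameters and growth in q\<close>

text \<open>With \<open>M\<close> of order \<open>q powr (1 / s ^ 3)\<close>, the box has at least
  \<open>(q / (4 * M)) ^ d\<close> points and is cut into \<open>O(M ^ (2 * s\<^sup>2))\<close>
  shells. The loss \<open>M ^ (d + 2 * s\<^sup>2)\<close> has exponent at most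
  \<open>22 * s\<^sup>2 / s ^ 3\<close> in \<open>q\<close>. The lower bound on \<open>d\<close>
  makes room for \<open>s\<close> blocks, the upper bound controls this exponent.\<close>

lemma IM_lower_bound_large_dim:
  fixes s d :: nat
  assumes "s \<ge> 1" "5 * s\<^sup>2 \<le> d" "d \<le> 20 * s\<^sup>2"
  shows "\<exists>c>0. \<forall>q::nat. q \<ge> 2 \<longrightarrow>
    c * real q powr (real d - 22 / real s) \<le> real (IM (residue_ring (int q)) d)"
proof -
  define M0 where "M0 = 8 * s * (s + 2) + 1"
  define K where "K = s ^ 3"
  define D where "D = 4 ^ d * real (16 * (s * (s + 2)) + 1)"
  \<comment> \<open>\<open>D\<close> collects the factor 4 per coordinate and the constant of the
    shell count; \<open>2 * M0\<close> comes from \<open>M \<le> 2 * M0 * z\<close>.\<close>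
  define c where "c = 1 / (D * (2 * real M0) ^ (d + 2 * s\<^sup>2))"
  have "D > 0" unfolding D_def by (simp add: add_pos_nonneg)
  have "c > 0" using \<open>D > 0\<close> by (simp add: c_def M0_def add_pos_nonneg)
  moreover have "c * real q powr (real d - 22 / real s) \<le> real (IM (residue_ring (int q)) d)"
    if q: "q \<ge> 2" for q
  proof -
    define z where "z = real q powr (1 / real K)"
    define m where "m = nat \<lceil>z\<rceil>"
    \<comment> \<open>The factor \<open>M0\<close> meets the lower bound on \<open>M\<close>, and
      \<open>m \<ge> z\<close> ensures \<open>q \<le> M ^ s ^ 3\<close>. Rounding \<open>z\<close>
      up at most doubles it, as \<open>z \<ge> 1\<close>.\<close>
    define M where "M = M0 * m"
    define X where "X = card {x::int. 0 \<le> x \<and> 4 * int M * x < int q}"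
    define I where "I = real (IM (residue_ring (int q)) d)"
    have "K \<ge> 1" using \<open>s \<ge> 1\<close> by (simp add: K_def)
    have "z \<ge> 1" unfolding z_def using q by (intro ge_one_powr_ge_zero) auto
    have m: "z \<le> real m" "real m \<le> 2 * z" "m \<ge> 1"
      unfolding m_def using \<open>z \<ge> 1\<close> by linarith+
    have "real q = z ^ K"
      using \<open>K \<ge> 1\<close> q by (simp add: z_def powr_realpow[symmetric] powr_powr)
    also have "\<dots> \<le> real m ^ K" using m(1) \<open>z \<ge> 1\<close> by (intro power_mono) auto
    finally have "q \<le> m ^ K" by (simp flip: of_nat_power)
    also have "\<dots> \<le> M ^ K" unfolding M_def M0_def by (intro power_mono) auto
    finally have qM: "q \<le> M ^ s ^ 3" by (simp add: K_def)
    have M: "M0 \<le> M" using m(3) by (simp add: M_def)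
    hence "M \<ge> 1" by (simp add: M0_def)
    have "s * (2 * s + 3) \<le> s * (5 * s)" using \<open>s \<ge> 1\<close> by (intro mult_left_mono) auto
    also have "\<dots> \<le> d" using assms(2) by (simp add: power2_eq_square mult_ac)
    finally have "s * (2 * s + 3) \<le> d" .
    from card_box_le_IM[OF q \<open>s \<ge> 1\<close> M[unfolded M0_def] qM this]
    have "X ^ d \<le> (16 * M ^ (2 * s\<^sup>2) * (s * (s + 2)) + 1) * IM (residue_ring (int q)) d"
      by (simp add: X_def)
    also have "\<dots> \<le> ((16 * (s * (s + 2)) + 1) * M ^ (2 * s\<^sup>2)) * IM (residue_ring (int q)) d"
      using \<open>M \<ge> 1\<close> by (intro mult_right_mono) (auto simp: algebra_simps)
    finally have X: "real X ^ d \<le> (real (16 * (s * (s + 2)) + 1) * real M ^ (2 * s\<^sup>2)) * I"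
      unfolding I_def by (metis of_nat_le_iff of_nat_mult of_nat_power)
    have "real q \<le> 4 * real M * real X"
    proof -
      \<comment> \<open>Rounding up is correct here: the integers from 0 that lie strictly below
        \<open>q / (4 * M)\<close> number exactly the ceiling, so \<open>X\<close> is at least this
        quotient even when it is below 1.\<close>
      define y where "y = \<lceil>real q / (4 * real M)\<rceil>"
      have "{0..<y} \<subseteq> {x::int. 0 \<le> x \<and> 4 * int M * x < int q}"
      proof
        fix x assume "x \<in> {0..<y}"
        hence "0 \<le> x" "real_of_int x < real q / (4 * real M)" by (auto simp: y_def less_ceiling_iff)
        hence "real_of_int (4 * int M * x) < real_of_int (int q)"
          using \<open>M \<ge> 1\<close> by (simp add: field_simps)
        thus "x \<in> {x. 0 \<le> x \<and> 4 * int M * x < int q}" using \<open>0 \<le> x\<close> by (simp only: of_int_less_iff mem_Collect_eq)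
      qed
      moreover have "{x::int. 0 \<le> x \<and> 4 * int M * x < int q} \<subseteq> {0..<int q}"
      proof
        fix x :: int assume x: "x \<in> {x. 0 \<le> x \<and> 4 * int M * x < int q}"
        have "1 * x \<le> 4 * int M * x" using x \<open>M \<ge> 1\<close> by (intro mult_right_mono) auto
        thus "x \<in> {0..<int q}" using x by simp
      qed
      ultimately have "card {0..<y} \<le> X"
        unfolding X_def by (metis card_mono finite_atLeastLessThan_int finite_subset)
      hence "real_of_int y \<le> real X" by (simp add: nat_le_iff)
      hence "real q / (4 * real M) \<le> real X" unfolding y_def by linarith
      thus ?thesis using \<open>M \<ge> 1\<close> by (simp add: field_simps)
    qed
    hence "real q ^ d \<le> (4 * real M * real X) ^ d" by (intro power_mono) auto
    also have "\<dots> = 4 ^ d * real M ^ d * real X ^ d" by (simp add: power_mult_distrib)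
    also have "\<dots> \<le> 4 ^ d * real M ^ d * ((real (16 * (s * (s + 2)) + 1) * real M ^ (2 * s\<^sup>2)) * I)"
      by (intro mult_left_mono X) auto
    also have "\<dots> = D * real M ^ (d + 2 * s\<^sup>2) * I" by (simp add: D_def power_add mult_ac)
    also have "\<dots> \<le> D * (2 * real M0 * z) ^ (d + 2 * s\<^sup>2) * I"
      using m(2) \<open>D > 0\<close>
      by (intro mult_right_mono mult_left_mono power_mono) (auto simp: M_def I_def mult.left_commute mult_left_mono mult.assoc)
    also have "\<dots> = z ^ (d + 2 * s\<^sup>2) * I / c"
      by (simp add: c_def power_mult_distrib)
    also have "\<dots> \<le> real q powr (22 / real s) * I / c"
    proof -
      have "z ^ (d + 2 * s\<^sup>2) = real q powr (real (d + 2 * s\<^sup>2) / real K)"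
        using q by (simp add: z_def powr_realpow[symmetric] powr_powr)
      also have "\<dots> \<le> real q powr (22 / real s)"
      proof (rule powr_mono)
        have "d + 2 * s\<^sup>2 \<le> 22 * s\<^sup>2" using assms(3) by simp
        hence "real (d + 2 * s\<^sup>2) \<le> 22 * (real s)\<^sup>2"
          by (metis of_nat_le_iff of_nat_mult of_nat_numeral of_nat_power)
        thus "real (d + 2 * s\<^sup>2) / real K \<le> 22 / real s"
          using \<open>s \<ge> 1\<close> by (simp add: K_def field_simps power2_eq_square power3_eq_cube)
      qed (use q in simp)
      finally show ?thesis using \<open>c > 0\<close>
        by (intro divide_right_mono mult_right_mono) (auto simp: I_def)
    qed
    finally have "c * real q ^ d \<le> real q powr (22 / real s) * I"
      using \<open>c > 0\<close> by (simp add: field_simps)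
    moreover have "real q powr (22 / real s) > 0" using q by simp
    ultimately show ?thesis
      using q by (simp add: powr_diff powr_realpow I_def field_simps)
  qed
  ultimately show ?thesis by blast
qed

section \<open>Small dimensions and uniformity in d\<close>

lemma IM_ge_1:
  fixes q d :: nat
  assumes "q \<ge> 2" "d \<ge> 1"
  shows "IM (residue_ring (int q)) d \<ge> 1"
proof -
  let ?R = "residue_ring (int q)"
  define p where "p = (\<lambda>i\<in>{..<d}. 0::int)"
  define v where "v = (\<lambda>i\<in>{..<d}. 1::int)"
  have "finite (carrier ?R)" by (simp add: residue_ring_def)
  moreover have pv: "p \<in> points ?R d" "v \<in> points ?R d"
    using assms by (auto simp: p_def v_def points_def residue_ring_def)
  moreover have "line_through ?R d p v \<in> affine_lines ?R d"
    unfolding affine_lines_def using pv assms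
    by (intro CollectI exI[of _ p] exI[of _ v] conjI refl exI[of _ 0])
      (simp_all add: v_def residue_ring_def)
  moreover have "p \<in> line_through ?R d p v"
    unfolding line_through_def using assms
    by (intro image_eqI[of _ _ 0]) (auto simp: p_def v_def residue_ring_def)
  ultimately show ?thesis
    using card_le_IM[of ?R "{p}" d] by auto
qed

text \<open>Converts the loss \<open>22 / s\<close>, of order \<open>1 / sqrt d\<close>, into the
  weaker bound by a multiple of \<open>1 / ln d\<close>.\<close>

lemma ln_le_2_sqrt:
  fixes x :: real
  assumes "x > 0"
  shows "ln x \<le> 2 * sqrt x"
  using ln_le_minus_one[of "sqrt x"] assms by (simp add: ln_sqrt)

lemma IM_lower_bound:
  fixes d :: nat
  assumes "d \<ge> 2"
  shows "\<exists>\<epsilon> c::real. \<epsilon> > 0 \<and> c > 0 \<and> \<epsilon> \<le> 200 * inverse (ln (real d)) \<and>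
    (\<forall>q::nat. q \<ge> 2 \<longrightarrow> c * real q powr (real d - \<epsilon>) \<le> real (IM (residue_ring (int q)) d))"
proof (cases "d < 5")
  case True
  \<comment> \<open>For \<open>d\<close> at most 4 the choice of 4 for the loss makes the exponent
    nonpositive, so a single incident pair suffices.\<close>
  have "ln (real d) > 0" using assms by simp
  moreover have "ln (real d) \<le> real d - 1" using assms by (intro ln_le_minus_one) auto
  ultimately have "4 \<le> 200 * inverse (ln (real d))" using True by (simp add: field_simps)
  moreover have "1 * real q powr (real d - 4) \<le> real (IM (residue_ring (int q)) d)"
    if "q \<ge> 2" for q
  proof -
    have "real q powr (real d - 4) \<le> real q powr 0"
      using that True by (intro powr_mono) auto
    also have "\<dots> \<le> real (IM (residue_ring (int q)) d)"
      using IM_ge_1[of q d] that assms by simp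
    finally show ?thesis by simp
  qed
  ultimately show ?thesis by (intro exI[of _ 4] exI[of _ 1]) auto
next
  case False
  \<comment> \<open>The largest \<open>s\<close> with \<open>5 * s\<^sup>2 \<le> d\<close>. It is at
    least 1, so \<open>sqrt (d / 5) \<le> s + 1 \<le> 2 * s\<close>, which yields
    \<open>d \<le> 20 * s\<^sup>2\<close>.\<close>
  define s where "s = nat \<lfloor>sqrt (real d / 5)\<rfloor>"
  have "sqrt (real d / 5) \<ge> 1" using False by simp
  hence s: "s \<ge> 1" "real s \<le> sqrt (real d / 5)" "sqrt (real d / 5) \<le> real s + 1"
    unfolding s_def by linarith+
  have "(real s)\<^sup>2 \<le> real d / 5"
    using power_mono[OF s(2), of 2] by simp
  hence "real (5 * s\<^sup>2) \<le> real d" by simp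
  hence le1: "5 * s\<^sup>2 \<le> d" by (simp only: of_nat_le_iff)
  have half: "sqrt (real d / 5) \<le> 2 * real s" using s(1,3) by simp
  have "real d / 5 \<le> (2 * real s)\<^sup>2"
    using power_mono[OF half, of 2] by simp
  hence "real d \<le> real (20 * s\<^sup>2)" by (simp add: power_mult_distrib)
  hence le2: "d \<le> 20 * s\<^sup>2" by (simp only: of_nat_le_iff)
  have "ln (real d) > 0" using assms by simp
  have "ln (real d) \<le> 2 * sqrt (real d)" using assms by (intro ln_le_2_sqrt) simp
  \<comment> \<open>Here \<open>9 / 2\<close> is a rational upper bound for \<open>sqrt 20\<close>.
    The resulting \<open>ln d \<le> 9 * s\<close> gives \<open>22 / s \<le> 198 / ln d\<close>,
    whence the constant 200.\<close>
  also have "\<dots> \<le> 2 * (9 / 2 * real s)"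
  proof -
    have "real d \<le> (9 / 2 * real s)\<^sup>2"
      using \<open>real d \<le> real (20 * s\<^sup>2)\<close> by (simp add: power_mult_distrib power_divide)
    hence "sqrt (real d) \<le> 9 / 2 * real s" by (intro real_le_lsqrt) auto
    thus ?thesis by simp
  qed
  finally have "22 / real s \<le> 200 * inverse (ln (real d))"
    using \<open>ln (real d) > 0\<close> s(1) by (simp add: field_simps)
  moreover have "22 / real s > 0" using s(1) by simp
  ultimately show ?thesis using IM_lower_bound_large_dim[OF s(1) le1 le2] by blast
qed

theorem theorem1p6:
  shows "\<exists>C::real. C > 0 \<and> (\<exists>(\<epsilon>::nat \<Rightarrow> real) (c::nat \<Rightarrow> real).
    (\<forall>d\<ge>2. \<epsilon> d > 0 \<and> c d > 0 \<and> \<epsilon> d \<le> C * inverse (ln (real d))) \<and>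
    (\<forall>d\<ge>2. \<forall>q::nat. prime q \<longrightarrow>
       real (IM (residue_ring (int q)) d) \<ge> c d * real q powr (real d - \<epsilon> d)))"
proof -
  define good where "good d \<epsilon> c \<longleftrightarrow> \<epsilon> > 0 \<and> c > 0 \<and> \<epsilon> \<le> 200 * inverse (ln (real d)) \<and>
      (\<forall>q::nat. q \<ge> 2 \<longrightarrow> c * real q powr (real d - \<epsilon>) \<le> real (IM (residue_ring (int q)) d))"
    for d \<epsilon> c
  have "\<forall>d. \<exists>\<epsilon> c. d \<ge> 2 \<longrightarrow> good d \<epsilon> c"
    unfolding good_def using IM_lower_bound by blast
  then obtain \<epsilon> c where "\<And>d. d \<ge> 2 \<Longrightarrow> good d (\<epsilon> d) (c d)" by metis
  thus ?thesis
    by (intro exI[of _ 200] conjI exI[of _ \<epsilon>] exI[of _ c]) (auto simp: good_def dest: prime_ge_2_nat)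
qed

end
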